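(* Let $\mu\in\mathbb{R}$, $\sigma>0$, let $1\le r<n$, $\ell\ge1$ and $r<s_1<s_2<\dots<s_\ell\le n$. Let $X_{1:n}<\dots<X_{n:n}$ be the order statistics of a sample of size $n$ from the density $\frac1\sigma f\left(\frac{x-\mu}{\sigma}\right)$, and let $\boldsymbol X=(X_{1:n},\dots,X_{r:n})^\top$. Then the simultaneous best linear invariant predictors of $(X_{s_1:n},\dots,X_{s_\ell:n})$ based on $\boldsymbol X$ are identical to the corresponding marginal best linear invariant predictors of $X_{s_1:n},\dots,X_{s_\ell:n}$.
   Context: $f$ is a probability density on $\mathbb{R}$, and the sample consists of $n$ i.i.d. random variables with density $\frac1\sigma f\left(\frac{x-\mu}{\sigma}\right)$ (location-scale family). The standardized order statistics are $Z_{i:n}=(X_{i:n}-\mu)/\sigma$, assumed to have finite second moments, and the $r\times r$ covariance matrix of $(Z_{1:n},\dots,Z_{r:n})^\top$ is assumed positive definite. Marginal best linear invariant predictor of $X_{s:n}$ ($r<s\le n$): the predictor $\boldsymbol a^\top\boldsymbol X$ minimizing $E[(\boldsymbol a^\top\boldsymbol X-X_{s:n})^2]$ over $\boldsymbol a\in\mathbb{R}^r$. Simultaneous best linear invariant predictors of $(X_{s_1:n},\dots,X_{s_\ell:n})$: the tuple $(\boldsymbol a_1^\top\boldsymbol X,\dots,\boldsymbol a_\ell^\top\boldsymbol X)$ minimizing, over $(\boldsymbol a_1,\dots,\boldsymbol a_\ell)\in(\mathbb{R}^r)^\ell$, the determinant of the $\ell\times\ell$ mean squared predictive error matrix $\boldsymbol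 W=(W_{ij})$, $W_{ij}=E[(\boldsymbol a_i^\top\boldsymbol X-X_{s_i:n})(\boldsymbol a_j^\top\boldsymbol X-X_{s_j:n})]$. Minimizations are for fixed $\mu,\sigma$, with no unbiasedness constraint. *)

theory Defs
  imports "HOL-Probability.Probability" "Jordan_Normal_Form.Determinant"
begin

text \<open>
  Vectors and matrices are those of Jordan_Normal_Form, since their sizes are natural numbers;
  names shared with HOL-Analysis are qualified.  Samples and order statistics are numbered from 1,
  vector entries and lists from 0.
\<close>

definition order_statistic :: "(nat \<Rightarrow> 'a \<Rightarrow> real) \<Rightarrow> nat \<Rightarrow> nat \<Rightarrow> 'a \<Rightarrow> real" where
  "order_statistic Y n i \<omega> = sort (map (\<lambda>j. Y j \<omega>) [1..<Suc n]) ! (i - 1)"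

definition covariance :: "'a measure \<Rightarrow> ('a \<Rightarrow> real) \<Rightarrow> ('a \<Rightarrow> real) \<Rightarrow> real" where
  "covariance M U V =
    (\<integral>\<omega>. (U \<omega> - (\<integral>\<omega>'. U \<omega>' \<partial>M)) * (V \<omega> - (\<integral>\<omega>'. V \<omega>' \<partial>M)) \<partial>M)"

definition covariance_matrix ::
    "'a measure \<Rightarrow> nat \<Rightarrow> (nat \<Rightarrow> 'a \<Rightarrow> real) \<Rightarrow> real Matrix.mat" where
  "covariance_matrix M r Z = Matrix.mat r r (\<lambda>(i, j). covariance M (Z (Suc i)) (Z (Suc j)))"

definition positive_definite :: "real Matrix.mat \<Rightarrow> bool" where
  "positive_definite A \<longleftrightarrow>
    square_mat A \<and> transpose_mat A = A \<and>
    (\<forall>v\<in>carrier_vec (dim_row A). v \<noteq> 0\<^sub>v (dim_row A) \<longrightarrow> scalar_prod v (A *\<^sub>v v) > 0)"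

definition observed :: "(nat \<Rightarrow> 'a \<Rightarrow> real) \<Rightarrow> nat \<Rightarrow> nat \<Rightarrow> 'a \<Rightarrow> real Matrix.vec" where
  "observed Y n r \<omega> = Matrix.vec r (\<lambda>i. order_statistic Y n (Suc i) \<omega>)"

definition prediction_error ::
    "(nat \<Rightarrow> 'a \<Rightarrow> real) \<Rightarrow> nat \<Rightarrow> nat \<Rightarrow> nat \<Rightarrow> real Matrix.vec \<Rightarrow> 'a \<Rightarrow> real" where
  "prediction_error Y n r s a \<omega> = scalar_prod a (observed Y n r \<omega>) - order_statistic Y n s \<omega>"

definition marginal_BLIP ::
    "'a measure \<Rightarrow> (nat \<Rightarrow> 'a \<Rightarrow> real) \<Rightarrow> nat \<Rightarrow> nat \<Rightarrow> nat \<Rightarrow> real Matrix.vec \<Rightarrow> bool" where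
  "marginal_BLIP M Y n r s =
    is_arg_min (\<lambda>a. \<integral>\<omega>. (prediction_error Y n r s a \<omega>)\<^sup>2 \<partial>M) (\<lambda>a. a \<in> carrier_vec r)"

definition mspe_matrix ::
    "'a measure \<Rightarrow> (nat \<Rightarrow> 'a \<Rightarrow> real) \<Rightarrow> nat \<Rightarrow> nat \<Rightarrow> nat list \<Rightarrow> real Matrix.vec list
      \<Rightarrow> real Matrix.mat" where
  "mspe_matrix M Y n r ss as = Matrix.mat (length ss) (length ss)
    (\<lambda>(i, j). \<integral>\<omega>. prediction_error Y n r (ss ! i) (as ! i) \<omega>
                * prediction_error Y n r (ss ! j) (as ! j) \<omega> \<partial>M)"

definition simultaneous_BLIP ::
    "'a measure \<Rightarrow> (nat \<Rightarrow> 'a \<Rightarrow> real) \<Rightarrow> nat \<Rightarrow> nat \<Rightarrow> nat list \<Rightarrow> real Matrix.vec list \<Rightarrow> bool" where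
  "simultaneous_BLIP M Y n r ss =
    is_arg_min (\<lambda>as. Determinant.det (mspe_matrix M Y n r ss as))
      (\<lambda>as. length as = length ss \<and> set as \<subseteq> carrier_vec r)"

end

theory Submission
  imports Defs
begin

text \<open>
  The order statistics have a positive definite second moment form: a linear relation among them
  would be one among the independent, atomless sample variables in some order. If \<open>a\<^sub>i\<close> solves the
  normal equations for \<open>s\<^sub>i\<close>, then moving each \<open>a\<^sub>i\<close> by \<open>d\<^sub>i\<close> changes the mean squared predictive
  error matrix from \<open>W\<close> to \<open>W + P\<close>, where \<open>P\<close> is the positive semidefinite Gram matrix of the
  \<open>d\<^sub>i\<close>. Since the errors involve distinct unobserved order statistics, \<open>W\<close> is positive definite, so
  \<open>det (W + P) \<ge> det W\<close> with equality only for \<open>P = 0\<close>, that is, only if all \<open>d\<^sub>i\<close> vanish.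
\<close>

section \<open>Bilinear forms given by coefficient functions\<close>

text \<open>Coefficients and vectors are total functions with the size as a separate parameter, so
  that restricting to fewer coordinates or shifting indices needs no carrier conditions.\<close>

definition bilin :: "nat \<Rightarrow> (nat \<Rightarrow> nat \<Rightarrow> real) \<Rightarrow> (nat \<Rightarrow> real) \<Rightarrow> (nat \<Rightarrow> real) \<Rightarrow> real" where
  "bilin n m x y = (\<Sum>i<n. \<Sum>j<n. x i * m i j * y j)"

definition symm_form :: "nat \<Rightarrow> (nat \<Rightarrow> nat \<Rightarrow> real) \<Rightarrow> bool" where
  "symm_form n m \<longleftrightarrow> (\<forall>i<n. \<forall>j<n. m i j = m j i)"

definition pos_def_form :: "nat \<Rightarrow> (nat \<Rightarrow> nat \<Rightarrow> real) \<Rightarrow> bool" where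
  "pos_def_form n m \<longleftrightarrow> symm_form n m \<and> (\<forall>x. (\<exists>i<n. x i \<noteq> 0) \<longrightarrow> 0 < bilin n m x x)"

definition pos_semidef_form :: "nat \<Rightarrow> (nat \<Rightarrow> nat \<Rightarrow> real) \<Rightarrow> bool" where
  "pos_semidef_form n m \<longleftrightarrow> symm_form n m \<and> (\<forall>x. 0 \<le> bilin n m x x)"

definition form_det :: "nat \<Rightarrow> (nat \<Rightarrow> nat \<Rightarrow> real) \<Rightarrow> real" where
  "form_det n m = Determinant.det (Matrix.mat n n (\<lambda>(i, j). m i j))"

text \<open>Coordinate 0 is eliminated and the remaining indices move down by one, which suits
  induction on the size.\<close>

definition schur_complement :: "(nat \<Rightarrow> nat \<Rightarrow> real) \<Rightarrow> nat \<Rightarrow> nat \<Rightarrow> real" where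
  "schur_complement m i j = m (Suc i) (Suc j) - m (Suc i) 0 * m 0 (Suc j) / m 0 0"

lemma bilin_add_form: "bilin n (\<lambda>i j. m i j + p i j) x y = bilin n m x y + bilin n p x y"
  by (simp add: bilin_def algebra_simps sum.distrib)

lemma bilin_add_left: "bilin n m (\<lambda>i. x i + z i) y = bilin n m x y + bilin n m z y"
  by (simp add: bilin_def algebra_simps sum.distrib)

lemma bilin_add_right: "bilin n m x (\<lambda>i. y i + z i) = bilin n m x y + bilin n m x z"
  by (simp add: bilin_def algebra_simps sum.distrib)

lemma bilin_commute:
  assumes "symm_form n m"
  shows "bilin n m x y = bilin n m y x"
proof -
  have "bilin n m x y = (\<Sum>i<n. \<Sum>j<n. y j * m j i * x i)"
    unfolding bilin_def using assms by (intro sum.cong refl) (auto simp: symm_form_def)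
  also have "\<dots> = bilin n m y x"
    unfolding bilin_def by (rule sum.swap)
  finally show ?thesis .
qed

text \<open>Bilinear expansion. It turns the value of a Gram matrix into a value of the original
  form at a linear combination, which is how Gram matrices inherit definiteness.\<close>

lemma bilin_sum:
  "bilin n m (\<lambda>k. \<Sum>i<l. x i * u i k) (\<lambda>k. \<Sum>j<l. y j * v j k)
    = bilin l (\<lambda>i j. bilin n m (u i) (v j)) x y"
proof -
  have "bilin n m (\<lambda>k. \<Sum>i<l. x i * u i k) (\<lambda>k. \<Sum>j<l. y j * v j k)
      = (\<Sum>a<n. \<Sum>b<n. \<Sum>i<l. \<Sum>j<l. x i * u i a * m a b * (y j * v j b))"
    by (simp add: bilin_def sum_distrib_left sum_distrib_right sum_product mult.assoc)
      (intro sum.cong refl sum.swap)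
  also have "\<dots> = (\<Sum>a<n. \<Sum>i<l. \<Sum>b<n. \<Sum>j<l. x i * u i a * m a b * (y j * v j b))"
    by (intro sum.cong refl sum.swap)
  also have "\<dots> = (\<Sum>i<l. \<Sum>a<n. \<Sum>b<n. \<Sum>j<l. x i * u i a * m a b * (y j * v j b))"
    by (rule sum.swap)
  also have "\<dots> = (\<Sum>i<l. \<Sum>a<n. \<Sum>j<l. \<Sum>b<n. x i * u i a * m a b * (y j * v j b))"
    by (intro sum.cong refl sum.swap)
  also have "\<dots> = (\<Sum>i<l. \<Sum>j<l. \<Sum>a<n. \<Sum>b<n. x i * u i a * m a b * (y j * v j b))"
    by (intro sum.cong refl sum.swap)
  also have "\<dots> = bilin l (\<lambda>i j. bilin n m (u i) (v j)) x y"
    by (simp add: bilin_def sum_distrib_left sum_distrib_right mult_ac)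
  finally show ?thesis .
qed

lemma pos_def_form_imp_semidef:
  assumes "pos_def_form n m"
  shows "pos_semidef_form n m"
proof -
  have "0 \<le> bilin n m x x" for x
  proof (cases "\<exists>i<n. x i \<noteq> 0")
    case True
    then show ?thesis using assms by (auto simp: pos_def_form_def intro: less_imp_le)
  next
    case False
    then have "bilin n m x x = 0" by (simp add: bilin_def)
    then show ?thesis by simp
  qed
  then show ?thesis using assms by (auto simp: pos_def_form_def pos_semidef_form_def)
qed

text \<open>Extending a vector by zeros embeds the smaller form in the larger one.\<close>

lemma pos_def_form_mono:
  assumes "pos_def_form n m" and "r \<le> n"
  shows "pos_def_form r m"
  unfolding pos_def_form_def
proof (intro conjI allI impI)
  show "symm_form r m" using assms by (auto simp: pos_def_form_def symm_form_def)
  fix x :: "nat \<Rightarrow> real"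
  assume "\<exists>i<r. x i \<noteq> 0"
  define y where "y = (\<lambda>i. if i < r then x i else 0)"
  have "\<exists>i<n. y i \<noteq> 0"
    using assms(2) \<open>\<exists>i<r. x i \<noteq> 0\<close> by (auto simp: y_def intro: less_le_trans)
  then have "0 < bilin n m y y"
    using assms(1) by (simp add: pos_def_form_def)
  also have "bilin n m y y = (\<Sum>i<r. \<Sum>j<n. y i * m i j * y j)"
    unfolding bilin_def using \<open>r \<le> n\<close>
    by (intro sum.mono_neutral_right) (auto simp: y_def)
  also have "\<dots> = (\<Sum>i<r. \<Sum>j<r. y i * m i j * y j)"
    using \<open>r \<le> n\<close>
    by (intro sum.cong refl sum.mono_neutral_right) (auto simp: y_def)
  also have "\<dots> = bilin r m x x"
    by (simp add: bilin_def y_def)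
  finally show "0 < bilin r m x x" .
qed

section \<open>Schur complements and determinants\<close>

text \<open>One round of Gaussian elimination: subtracting multiples of row 0 clears the rest of
  column 0, keeps the determinant, and leaves the Schur complement in the lower right block.\<close>

lemma form_det_schur_complement:
  assumes "m 0 0 \<noteq> 0"
  shows "form_det (Suc n) m = m 0 0 * form_det n (schur_complement m)"
proof -
  let ?A = "Matrix.mat (Suc n) (Suc n) (\<lambda>(i, j). m i j)"
  let ?L = "Matrix.mat (Suc n) (Suc n)
    (\<lambda>(i, j). if i = j then 1 else if j = 0 then - m i 0 / m 0 0 else 0)"
  let ?S = "Matrix.mat n n (\<lambda>(i, j). schur_complement m i j)"
  let ?B = "four_block_mat (Matrix.mat 1 1 (\<lambda>_. m 0 0))
    (Matrix.mat 1 n (\<lambda>(i, j). m 0 (Suc j))) (0\<^sub>m n 1) ?S"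
  have det_L: "Determinant.det ?L = 1"
  proof -
    have "Determinant.det ?L = prod_list (diag_mat ?L)"
      by (rule det_lower_triangular[of "Suc n"]) auto
    also have "diag_mat ?L = map (\<lambda>_. 1) [0..<Suc n]"
      unfolding diag_mat_def by (intro map_cong) auto
    finally show ?thesis by (simp add: map_replicate_const)
  qed
  have "?L * ?A = ?B"
  proof (rule eq_matI)
    fix i j
    assume "i < dim_row ?B" and "j < dim_col ?B"
    then have ij: "i < Suc n" "j < Suc n" by auto
    then have "(?L * ?A) $$ (i, j) = (\<Sum>k<Suc n. ?L $$ (i, k) * ?A $$ (k, j))"
      by (simp add: scalar_prod_def atLeast0LessThan del: sum.lessThan_Suc)
    \<comment> \<open>Row \<open>i\<close> of \<open>?L\<close> has a 1 in column \<open>i\<close>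
      and the multiplier in column 0. For \<open>i = 0\<close> the two places coincide, hence the
      inner case distinction.\<close>
    also have "\<dots> = (\<Sum>k<Suc n. (if k = i then m i j else 0) +
        (if k = 0 then (if i = 0 then 0 else - m i 0 / m 0 0 * m 0 j) else 0))"
      using ij by (intro sum.cong refl) auto
    also have "\<dots> = m i j + (if i = 0 then 0 else - m i 0 / m 0 0 * m 0 j)"
      unfolding sum.distrib sum.delta[OF finite_lessThan] using ij by simp
    also have "\<dots> = ?B $$ (i, j)"
      using ij assms by (cases i; cases j) (auto simp: schur_complement_def)
    finally show "(?L * ?A) $$ (i, j) = ?B $$ (i, j)" .
  qed auto
  then have "Determinant.det ?A = Determinant.det ?B"
    using det_mult[of ?L "Suc n" ?A] det_L by simp
  also have "\<dots> = Determinant.det (Matrix.mat 1 1 (\<lambda>_. m 0 0)) * Determinant.det ?S"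
    by (rule det_four_block_mat_lower_left_zero) auto
  also have "Determinant.det (Matrix.mat 1 1 (\<lambda>_. m 0 0)) = m 0 0"
    by (subst det_single) auto
  finally show ?thesis by (simp add: form_det_def)
qed

lemma bilin_Suc:
  assumes "symm_form (Suc n) m"
  shows "bilin (Suc n) m (case_nat t x) (case_nat t x)
    = t\<^sup>2 * m 0 0 + 2 * t * (\<Sum>j<n. m 0 (Suc j) * x j) + bilin n (\<lambda>i j. m (Suc i) (Suc j)) x x"
proof -
  have "(\<Sum>i<n. x i * m (Suc i) 0 * t) = t * (\<Sum>j<n. m 0 (Suc j) * x j)"
    using assms unfolding sum_distrib_left symm_form_def
    by (intro sum.cong refl) auto
  moreover have "(\<Sum>j<n. t * m 0 (Suc j) * x j) = t * (\<Sum>j<n. m 0 (Suc j) * x j)"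
    by (simp add: sum_distrib_left mult.assoc)
  ultimately show ?thesis
    by (simp add: bilin_def sum.lessThan_Suc_shift sum.distrib power2_eq_square
        del: sum.lessThan_Suc)
qed

text \<open>Completing the square in coordinate 0: \<open>t\<close> then occurs only inside the
  square and can be chosen to make it vanish.\<close>

lemma bilin_schur_complement:
  assumes "symm_form (Suc n) m" and "m 0 0 \<noteq> 0"
  shows "bilin (Suc n) m (case_nat t x) (case_nat t x)
    = m 0 0 * (t + (\<Sum>j<n. m 0 (Suc j) * x j) / m 0 0)\<^sup>2 + bilin n (schur_complement m) x x"
proof -
  let ?b = "\<Sum>j<n. m 0 (Suc j) * x j"
  have "bilin n (schur_complement m) x x
      = bilin n (\<lambda>i j. m (Suc i) (Suc j)) x x
        - (\<Sum>i<n. \<Sum>j<n. m 0 (Suc i) * x i * (m 0 (Suc j) * x j)) / m 0 0"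
    using assms(1)
    by (simp add: bilin_def schur_complement_def symm_form_def algebra_simps sum_subtractf
        sum_divide_distrib diff_divide_distrib)
  also have "(\<Sum>i<n. \<Sum>j<n. m 0 (Suc i) * x i * (m 0 (Suc j) * x j)) = ?b\<^sup>2"
    by (simp add: sum_product power2_eq_square)
  finally show ?thesis
    unfolding bilin_Suc[OF assms(1)] using assms(2)
    by (simp add: power2_sum power_divide) (simp add: field_simps power2_eq_square)
qed

lemma symm_form_schur_complement:
  "symm_form (Suc n) m \<Longrightarrow> symm_form n (schur_complement m)"
  by (auto simp: symm_form_def schur_complement_def)

lemma pos_def_form_pivot:
  assumes "pos_def_form (Suc n) m"
  shows "0 < m 0 0"
proof -
  let ?x = "case_nat 1 (\<lambda>_. 0) :: nat \<Rightarrow> real"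
  have "0 < bilin (Suc n) m ?x ?x"
    using assms unfolding pos_def_form_def by (metis old.nat.simps(4) zero_less_Suc zero_neq_one)
  also have "bilin (Suc n) m ?x ?x = m 0 0"
    using assms by (subst bilin_Suc) (auto simp: pos_def_form_def bilin_def)
  finally show ?thesis .
qed

lemma pos_def_form_schur_complement:
  assumes "pos_def_form (Suc n) m"
  shows "pos_def_form n (schur_complement m)"
  unfolding pos_def_form_def
proof (intro conjI allI impI)
  have symm: "symm_form (Suc n) m" using assms by (simp add: pos_def_form_def)
  show "symm_form n (schur_complement m)" using symm by (rule symm_form_schur_complement)
  fix x :: "nat \<Rightarrow> real"
  assume "\<exists>i<n. x i \<noteq> 0"
  then obtain i where "i < n" "x i \<noteq> 0" by blast
  \<comment> \<open>This \<open>t\<close> makes the completed square vanish, so the form at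
    \<open>case_nat t x\<close> equals the Schur complement at \<open>x\<close>.\<close>
  define t where "t = - (\<Sum>j<n. m 0 (Suc j) * x j) / m 0 0"
  have "0 < bilin (Suc n) m (case_nat t x) (case_nat t x)"
    using assms \<open>i < n\<close> \<open>x i \<noteq> 0\<close> unfolding pos_def_form_def
    by (metis Suc_less_eq old.nat.simps(5))
  then show "0 < bilin n (schur_complement m) x x"
    using bilin_schur_complement[OF symm, of t x] pos_def_form_pivot[OF assms]
    by (simp add: t_def)
qed

lemma bilin_unit:
  assumes "j < n"
  shows "bilin n m (\<lambda>k. if k = j then 1 else 0) (\<lambda>k. if k = j then 1 else 0) = m j j"
proof -
  have "bilin n m (\<lambda>k. if k = j then 1 else 0) (\<lambda>k. if k = j then 1 else 0)
      = (\<Sum>a<n. \<Sum>b<n. if b = j then if a = j then m j j else 0 else 0)"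
    unfolding bilin_def by (intro sum.cong refl) simp
  also have "\<dots> = m j j" using assms by simp
  finally show ?thesis .
qed

lemma pos_semidef_form_diag:
  assumes "pos_semidef_form n p" and "i < n"
  shows "0 \<le> p i i"
  using assms(1) bilin_unit[OF assms(2), of p] unfolding pos_semidef_form_def by metis

text \<open>With \<open>p 0 0 = 0\<close> the form at \<open>case_nat t x\<close> is affine in
  \<open>t\<close>, and a nonzero slope would let it become negative.\<close>

lemma pos_semidef_form_zero_pivot:
  assumes "pos_semidef_form (Suc n) p" and "p 0 0 = 0" and "j < n"
  shows "p 0 (Suc j) = 0"
proof (rule ccontr)
  assume nz: "p 0 (Suc j) \<noteq> 0"
  let ?x = "\<lambda>k. if k = j then 1 else 0 :: real"
  \<comment> \<open>Chosen so that this affine function takes the value -1.\<close>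
  define t where "t = - (p (Suc j) (Suc j) + 1) / (2 * p 0 (Suc j))"
  have "0 \<le> bilin (Suc n) p (case_nat t ?x) (case_nat t ?x)"
    using assms(1) by (simp add: pos_semidef_form_def)
  also have "\<dots> = 2 * t * p 0 (Suc j) + p (Suc j) (Suc j)"
    using assms bilin_unit[OF assms(3), of "\<lambda>i j. p (Suc i) (Suc j)"]
    by (subst bilin_Suc)
      (simp_all add: pos_semidef_form_def if_distrib[of "\<lambda>x. _ * x"] cong: if_cong)
  also have "\<dots> = -1"
    using nz by (simp add: t_def field_simps)
  finally show False by simp
qed

text \<open>The Schur complement is the minimum of the form over the eliminated coordinate, hence
  superadditive; this carries the comparison of determinants through the induction.\<close>

lemma pos_semidef_form_schur_complement_diff:
  assumes w: "pos_def_form (Suc n) w" and p: "pos_semidef_form (Suc n) p"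
  defines "v \<equiv> \<lambda>i j. w i j + p i j"
  shows "pos_semidef_form n (\<lambda>i j. schur_complement v i j - schur_complement w i j)"
  unfolding pos_semidef_form_def
proof (intro conjI allI)
  have symm: "symm_form (Suc n) w" "symm_form (Suc n) v"
    using w p by (auto simp: pos_def_form_def pos_semidef_form_def symm_form_def v_def)
  show "symm_form n (\<lambda>i j. schur_complement v i j - schur_complement w i j)"
    using symm[THEN symm_form_schur_complement] by (simp add: symm_form_def)
  have pivot: "0 < w 0 0" "0 < v 0 0"
    using pos_def_form_pivot[OF w] pos_semidef_form_diag[OF p, of 0] by (auto simp: v_def)
  fix x :: "nat \<Rightarrow> real"
  \<comment> \<open>The minimizer of \<open>v\<close> over coordinate 0: the square vanishes for
    \<open>v\<close>, while for \<open>w\<close> it only has to be nonnegative.\<close>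
  define t where "t = - (\<Sum>j<n. v 0 (Suc j) * x j) / v 0 0"
  let ?y = "case_nat t x"
  have "bilin n (schur_complement w) x x \<le> bilin (Suc n) w ?y ?y"
    using bilin_schur_complement[OF symm(1), of t x] pivot by simp
  also have "\<dots> \<le> bilin (Suc n) w ?y ?y + bilin (Suc n) p ?y ?y"
    using p by (simp add: pos_semidef_form_def)
  also have "\<dots> = bilin (Suc n) v ?y ?y"
    by (simp add: v_def bilin_add_form)
  also have "\<dots> = bilin n (schur_complement v) x x"
    using bilin_schur_complement[OF symm(2), of t x] pivot by (simp add: t_def)
  also have "\<dots> = bilin n (schur_complement w) x x
      + bilin n (\<lambda>i j. schur_complement v i j - schur_complement w i j) x x"
    by (simp add: bilin_add_form[symmetric])
  finally show "0 \<le> bilin n (\<lambda>i j. schur_complement v i j - schur_complement w i j) x x"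
    by simp
qed

text \<open>The determinant is the product of the pivots of successive eliminations, and each of
  them is positive.\<close>

lemma form_det_pos:
  "pos_def_form n m \<Longrightarrow> 0 < form_det n m"
proof (induction n arbitrary: m)
  case 0
  then show ?case by (simp add: form_det_def)
next
  case (Suc n)
  then show ?case
    using pos_def_form_pivot[OF Suc.prems] pos_def_form_schur_complement[OF Suc.prems]
    by (simp add: form_det_schur_complement)
qed

text \<open>Induction on the size: the determinant is the pivot times the determinant of the Schur
  complement, and adding \<open>p\<close> decreases neither factor. The equality case is carried
  along, since equality passes to the Schur complements.\<close>

lemma form_det_add_mono:
  assumes "pos_def_form n w" and "pos_semidef_form n p"
  shows "form_det n w \<le> form_det n (\<lambda>i j. w i j + p i j)"
    and "form_det n (\<lambda>i j. w i j + p i j) = form_det n w \<Longrightarrow> i < n \<Longrightarrow> j < n \<Longrightarrow> p i j = 0"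
proof -
  have "form_det n w \<le> form_det n (\<lambda>i j. w i j + p i j) \<and>
    (form_det n (\<lambda>i j. w i j + p i j) = form_det n w \<longrightarrow> (\<forall>i<n. \<forall>j<n. p i j = 0))"
    using assms
  proof (induction n arbitrary: w p)
    case 0
    then show ?case by (simp add: form_det_def)
  next
    case (Suc n)
    define v where "v = (\<lambda>i j. w i j + p i j)"
    let ?w = "schur_complement w" and ?v = "schur_complement v"
    have w00: "0 < w 0 0" and p00: "0 \<le> p 0 0"
      using pos_def_form_pivot Suc.prems pos_semidef_form_diag by blast+
    have w': "pos_def_form n ?w"
      using Suc.prems(1) by (rule pos_def_form_schur_complement)
    have IH: "form_det n ?w \<le> form_det n ?v"
      "form_det n ?v = form_det n ?w \<Longrightarrow> \<forall>i<n. \<forall>j<n. ?v i j - ?w i j = 0"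
      using Suc.IH[OF w' pos_semidef_form_schur_complement_diff[OF Suc.prems]]
      by (simp_all add: v_def)
    have det_w: "form_det (Suc n) w = w 0 0 * form_det n ?w"
      using w00 by (simp add: form_det_schur_complement)
    have det_v: "form_det (Suc n) v = (w 0 0 + p 0 0) * form_det n ?v"
      using w00 p00 by (subst form_det_schur_complement) (auto simp: v_def)
    have pos: "0 < form_det n ?w" using w' by (rule form_det_pos)
    have le: "w 0 0 * form_det n ?w \<le> w 0 0 * form_det n ?v"
      "0 \<le> p 0 0 * form_det n ?v"
      using IH(1) w00 p00 pos by auto
    have "p i j = 0" if eq: "form_det (Suc n) v = form_det (Suc n) w" and "i < Suc n" "j < Suc n"
      for i j
    proof -
      \<comment> \<open>The two inequalities in \<open>le\<close> add up to the comparison of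
        determinants, so equality makes both of them tight.\<close>
      have "p 0 0 * form_det n ?v = 0" "w 0 0 * form_det n ?w = w 0 0 * form_det n ?v"
        using eq le unfolding det_w det_v distrib_right by linarith+
      then have p0: "p 0 0 = 0" and det_eq: "form_det n ?v = form_det n ?w"
        using IH(1) pos w00 by auto
      have row: "p 0 (Suc k) = 0" if "k < n" for k
        using pos_semidef_form_zero_pivot[OF Suc.prems(2) p0 that] .
      have col: "p (Suc k) 0 = 0" if "k < n" for k
        using row[OF that] Suc.prems(2) that by (simp add: pos_semidef_form_def symm_form_def)
      \<comment> \<open>With row and column 0 of \<open>p\<close> zero, the correction terms of both
        Schur complements agree, and their difference is \<open>p\<close> at the shifted
        indices.\<close>
      have "p (Suc a) (Suc b) = 0" if "a < n" "b < n" for a b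
      proof -
        have "?v a b - ?w a b = 0" using IH(2)[OF det_eq] that by blast
        then show ?thesis
          using row[OF that(2)] col[OF that(1)] p0 by (simp add: schur_complement_def v_def)
      qed
      then show ?thesis using row col p0 that by (cases i; cases j) auto
    qed
    moreover have "form_det (Suc n) w \<le> form_det (Suc n) v"
      unfolding det_w det_v using le by (simp add: algebra_simps)
    ultimately show ?case by (auto simp: v_def)
  qed
  then show "form_det n w \<le> form_det n (\<lambda>i j. w i j + p i j)"
    and "form_det n (\<lambda>i j. w i j + p i j) = form_det n w \<Longrightarrow> i < n \<Longrightarrow> j < n \<Longrightarrow> p i j = 0"
    by blast+
qed

text \<open>The determinant is positive, so the matrix has an inverse, which is applied to the
  right-hand side.\<close>

lemma pos_def_form_solve:
  assumes "pos_def_form r m"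
  shows "\<exists>a\<in>carrier_vec r. \<forall>k<r. (\<Sum>i<r. m k i * vec_index a i) = b k"
proof -
  let ?A = "Matrix.mat r r (\<lambda>(i, j). m i j)"
  have "Determinant.det ?A \<noteq> 0"
    using form_det_pos[OF assms] by (simp add: form_det_def)
  then have "?A \<in> Units (ring_mat TYPE(real) r ())"
    by (intro det_non_zero_imp_unit) auto
  then obtain B where B: "B \<in> carrier_mat r r" "?A * B = 1\<^sub>m r"
    by (auto simp: Units_def ring_mat_def)
  define a where "a = B *\<^sub>v Matrix.vec r b"
  have a: "a \<in> carrier_vec r" using B by (simp add: a_def)
  have "?A *\<^sub>v a = (?A * B) *\<^sub>v Matrix.vec r b"
    unfolding a_def using B by (intro assoc_mult_mat_vec[symmetric]) auto
  then have eq: "?A *\<^sub>v a = Matrix.vec r b" using B by simp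
  have "(\<Sum>i<r. m k i * vec_index a i) = b k" if "k < r" for k
    using arg_cong[OF eq, of "\<lambda>v. vec_index v k"] that a
    by (simp add: scalar_prod_def atLeast0LessThan)
  then show ?thesis using a by blast
qed

section \<open>Predictors, their errors and the normal equations\<close>

definition pad_coeffs :: "nat \<Rightarrow> real Matrix.vec \<Rightarrow> nat \<Rightarrow> real" where
  "pad_coeffs r a k = (if k < r then vec_index a k else 0)"

text \<open>The coefficients of the error of predictor \<open>a\<close> over all order statistics;
  the target \<open>s\<close> is counted from 0.\<close>

definition error_coeffs :: "nat \<Rightarrow> nat \<Rightarrow> real Matrix.vec \<Rightarrow> nat \<Rightarrow> real" where
  "error_coeffs r s a k = pad_coeffs r a k - (if k = s then 1 else 0)"

text \<open>Orthogonality, with respect to \<open>m\<close>, of the error to all combinations of the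
  observed variables. No carrier condition on \<open>d\<close> is imposed, because
  \<open>pad_coeffs\<close> reads only the first \<open>r\<close> entries.\<close>

definition normal_equations :: "nat \<Rightarrow> (nat \<Rightarrow> nat \<Rightarrow> real) \<Rightarrow> nat \<Rightarrow> nat \<Rightarrow> real Matrix.vec \<Rightarrow> bool" where
  "normal_equations n m r s a \<longleftrightarrow>
    a \<in> carrier_vec r \<and> (\<forall>d. bilin n m (pad_coeffs r d) (error_coeffs r s a) = 0)"

lemma sum_mult_error_coeffs:
  assumes "s < n" and "r \<le> n"
  shows "(\<Sum>k<n. f k * error_coeffs r s a k) = (\<Sum>k<r. f k * vec_index a k) - f s"
proof -
  have "f k * error_coeffs r s a k = f k * pad_coeffs r a k - (if k = s then f k else 0)" for k
    by (simp add: error_coeffs_def right_diff_distrib)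
  then have "(\<Sum>k<n. f k * error_coeffs r s a k) = (\<Sum>k<n. f k * pad_coeffs r a k) - f s"
    using \<open>s < n\<close> by (simp add: sum_subtractf)
  also have "(\<Sum>k<n. f k * pad_coeffs r a k) = (\<Sum>k<r. f k * pad_coeffs r a k)"
    using \<open>r \<le> n\<close> by (intro sum.mono_neutral_right) (auto simp: pad_coeffs_def)
  finally show ?thesis by (simp add: pad_coeffs_def)
qed

text \<open>Orthogonality to the first \<open>r\<close> coordinates suffices. This is a linear
  system whose matrix is the leading block of \<open>m\<close>, again positive definite.\<close>

lemma normal_equations_solvable:
  assumes m: "pos_def_form n m" and "r \<le> n" and "s < n"
  shows "\<exists>a. normal_equations n m r s a"
proof -
  obtain a where a: "a \<in> carrier_vec r"
    and eq: "\<And>k. k < r \<Longrightarrow> (\<Sum>i<r. m k i * vec_index a i) = m k s"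
    using pos_def_form_solve[OF pos_def_form_mono[OF m \<open>r \<le> n\<close>], of "\<lambda>k. m k s"] by blast
  have "(\<Sum>j<n. m k j * error_coeffs r s a j) = 0" if "k < r" for k
    using sum_mult_error_coeffs[OF \<open>s < n\<close> \<open>r \<le> n\<close>] eq[OF that] by simp
  then have "pad_coeffs r d i * (\<Sum>j<n. m i j * error_coeffs r s a j) = 0" for d i
    by (simp add: pad_coeffs_def)
  then have "bilin n m (pad_coeffs r d) (error_coeffs r s a) = 0" for d
    unfolding bilin_def mult.assoc sum_distrib_left[symmetric] by (intro sum.neutral ballI)
  then show ?thesis using a by (auto simp: normal_equations_def)
qed

text \<open>Pythagoras: changing the predictors alters the errors by combinations of observed
  variables, to which the optimal errors are orthogonal, so the mixed terms vanish. Two targets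
  \<open>s\<close> and \<open>t\<close> are allowed for the sake of the off-diagonal
  entries.\<close>

lemma bilin_error_coeffs:
  assumes m: "symm_form n m"
    and a: "normal_equations n m r s a" and b: "normal_equations n m r t b"
    and c: "c \<in> carrier_vec r" and d: "d \<in> carrier_vec r"
  shows "bilin n m (error_coeffs r s c) (error_coeffs r t d)
    = bilin n m (error_coeffs r s a) (error_coeffs r t b)
      + bilin n m (pad_coeffs r (c - a)) (pad_coeffs r (d - b))"
proof -
  have split: "error_coeffs r s c = (\<lambda>k. error_coeffs r s a k + pad_coeffs r (c - a) k)"
    "error_coeffs r t d = (\<lambda>k. error_coeffs r t b k + pad_coeffs r (d - b) k)"
    using a b c d by (auto simp: error_coeffs_def pad_coeffs_def normal_equations_def)
  have "bilin n m (pad_coeffs r (c - a)) (error_coeffs r t b) = 0"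
    "bilin n m (error_coeffs r s a) (pad_coeffs r (d - b)) = 0"
    using a b bilin_commute[OF m, of "error_coeffs r s a"] by (auto simp: normal_equations_def)
  then show ?thesis
    unfolding split bilin_add_left bilin_add_right by simp
qed

lemma bilin_pad_coeffs_pos:
  assumes m: "pos_def_form n m" and "r \<le> n"
    and "a \<in> carrier_vec r" "b \<in> carrier_vec r" "b \<noteq> a"
  shows "0 < bilin n m (pad_coeffs r (b - a)) (pad_coeffs r (b - a))"
proof -
  have "\<exists>i<r. vec_index b i \<noteq> vec_index a i"
  proof (rule ccontr)
    assume "\<not> ?thesis"
    then have "b = a" using assms by (intro eq_vecI) auto
    then show False using \<open>b \<noteq> a\<close> by simp
  qed
  then have "\<exists>i<n. pad_coeffs r (b - a) i \<noteq> 0"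
    using assms by (auto simp: pad_coeffs_def intro: less_le_trans)
  then show ?thesis using m by (simp add: pos_def_form_def)
qed

lemma bilin_error_coeffs_minimal:
  assumes m: "pos_def_form n m" and r: "r \<le> n" and a: "normal_equations n m r s a"
    and b: "b \<in> carrier_vec r" "b \<noteq> a"
  shows "bilin n m (error_coeffs r s a) (error_coeffs r s a)
    < bilin n m (error_coeffs r s b) (error_coeffs r s b)"
proof -
  have "symm_form n m" using m by (simp add: pos_def_form_def)
  then have "bilin n m (error_coeffs r s b) (error_coeffs r s b)
    = bilin n m (error_coeffs r s a) (error_coeffs r s a)
      + bilin n m (pad_coeffs r (b - a)) (pad_coeffs r (b - a))"
    using bilin_error_coeffs a b(1) by blast
  moreover have "0 < bilin n m (pad_coeffs r (b - a)) (pad_coeffs r (b - a))"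
    using bilin_pad_coeffs_pos[OF m r _ b] a by (simp add: normal_equations_def)
  ultimately show ?thesis by simp
qed

lemma form_det_error_coeffs_minimal:
  assumes m: "pos_def_form n m" and r: "r \<le> n" and inj: "inj_on t {..<l}"
    and t: "\<And>i. i < l \<Longrightarrow> r \<le> t i \<and> t i < n"
    and a: "\<And>i. i < l \<Longrightarrow> normal_equations n m r (t i) (a i)"
    and b: "\<And>i. i < l \<Longrightarrow> b i \<in> carrier_vec r" and ne: "\<exists>i<l. b i \<noteq> a i"
  shows "form_det l (\<lambda>i j. bilin n m (error_coeffs r (t i) (a i)) (error_coeffs r (t j) (a j)))
    < form_det l (\<lambda>i j. bilin n m (error_coeffs r (t i) (b i)) (error_coeffs r (t j) (b j)))"
proof -
  define w where
    "w = (\<lambda>i j. bilin n m (error_coeffs r (t i) (a i)) (error_coeffs r (t j) (a j)))"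
  define p where
    "p = (\<lambda>i j. bilin n m (pad_coeffs r (b i - a i)) (pad_coeffs r (b j - a j)))"
  have symm: "symm_form n m" using m by (simp add: pos_def_form_def)
  have w: "pos_def_form l w"
    unfolding pos_def_form_def
  proof (intro conjI allI impI)
    show "symm_form l w"
      unfolding symm_form_def w_def using bilin_commute[OF symm] by blast
    fix x :: "nat \<Rightarrow> real"
    assume "\<exists>i<l. x i \<noteq> 0"
    then obtain i where i: "i < l" "x i \<noteq> 0" by blast
    let ?y = "\<lambda>k. \<Sum>i<l. x i * error_coeffs r (t i) (a i) k"
    \<comment> \<open>The index \<open>t i\<close> is unobserved, so no predictor involves it, and
      by injectivity of \<open>t\<close> only the error with number \<open>i\<close> does, with
      coefficient -1. Hence \<open>?y (t i) = - x i\<close>.\<close>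
    have "error_coeffs r (t j) (a j) (t i) = (if j = i then -1 else 0)" if "j < l" for j
    proof -
      have "t i = t j \<longleftrightarrow> i = j" using inj i(1) that by (auto simp: inj_on_eq_iff)
      then show ?thesis using t[OF i(1)] by (auto simp: error_coeffs_def pad_coeffs_def)
    qed
    then have "?y (t i) = (\<Sum>j<l. if j = i then - x j else 0)"
      by (intro sum.cong refl) auto
    then have "?y (t i) \<noteq> 0" using i by simp
    then have "\<exists>k<n. ?y k \<noteq> 0" using t[OF i(1)] by (intro exI[of _ "t i"]) simp
    then have "0 < bilin n m ?y ?y"
      using m unfolding pos_def_form_def by (elim conjE allE[of _ ?y]) (rule mp)
    then show "0 < bilin l w x x"
      unfolding w_def by (simp add: bilin_sum)
  qed
  have p: "pos_semidef_form l p"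
    unfolding pos_semidef_form_def
  proof (intro conjI allI)
    show "symm_form l p"
      unfolding symm_form_def p_def using bilin_commute[OF symm] by blast
    fix x :: "nat \<Rightarrow> real"
    show "0 \<le> bilin l p x x"
      using pos_def_form_imp_semidef[OF m]
      unfolding p_def bilin_sum[symmetric] pos_semidef_form_def by blast
  qed
  obtain i where i: "i < l" "b i \<noteq> a i" using ne by blast
  then have "p i i > 0"
    unfolding p_def using bilin_pad_coeffs_pos[OF m r] a b by (simp add: normal_equations_def)
  \<comment> \<open>Equality of the determinants would force \<open>p i i = 0\<close>.\<close>
  then have "form_det l w < form_det l (\<lambda>i j. w i j + p i j)"
    using form_det_add_mono(1)[OF w p] form_det_add_mono(2)[OF w p _ i(1) i(1)] by force
  moreover have "form_det l (\<lambda>i j. w i j + p i j)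
      = form_det l (\<lambda>i j. bilin n m (error_coeffs r (t i) (b i)) (error_coeffs r (t j) (b j)))"
    unfolding form_det_def w_def p_def using bilin_error_coeffs[OF symm a a b b]
    by (intro arg_cong[of _ _ Determinant.det] cong_mat) auto
  ultimately show ?thesis by (simp add: w_def)
qed

section \<open>Order statistics as permuted sample values and as random variables\<close>

text \<open>Sorting only permutes the sample. The permutation depends on \<omega> and acts on
  positions counted from 0, whereas the sample is numbered from 1.\<close>

lemma order_statistic_permutes:
  obtains p where "p permutes {..<n}"
    and "\<And>k. k < n \<Longrightarrow> order_statistic Y n (Suc k) \<omega> = Y (Suc (p k)) \<omega>"
proof -
  let ?xs = "map (\<lambda>j. Y j \<omega>) [1..<Suc n]"
  obtain p where p: "p permutes {..<length ?xs}" "permute_list p ?xs = sort ?xs"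
    using mset_eq_permutation[of "sort ?xs" ?xs] by (metis mset_sort)
  have p': "p permutes {..<n}" using p(1) by (simp del: upt_Suc)
  have "order_statistic Y n (Suc k) \<omega> = Y (Suc (p k)) \<omega>" if "k < n" for k
  proof -
    have "p k < n" using permutes_in_image[OF p'] that by simp
    have "order_statistic Y n (Suc k) \<omega> = permute_list p ?xs ! k"
      unfolding p(2) by (simp add: order_statistic_def)
    also have "\<dots> = ?xs ! p k"
      using p(1) that by (subst permute_list_nth) auto
    also have "\<dots> = Y (Suc (p k)) \<omega>"
      using \<open>p k < n\<close> by (simp del: upt_Suc)
    finally show ?thesis .
  qed
  with p' show thesis by (rule that)
qed

text \<open>The entries at most \<open>t\<close> form an initial segment of a sorted list.\<close>

lemma sorted_nth_le_iff:
  fixes xs :: "'a::linorder list"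
  assumes "sorted xs" and "k < length xs"
  shows "xs ! k \<le> t \<longleftrightarrow> k < length (filter (\<lambda>x. x \<le> t) xs)"
  using assms
proof (induction xs arbitrary: k)
  case (Cons x xs)
  show ?case
  proof (cases "x \<le> t")
    case True
    then show ?thesis using Cons by (cases k) auto
  next
    case False
    then have "\<forall>y\<in>set (x # xs). \<not> y \<le> t" using Cons.prems(1) by auto
    moreover have "(x # xs) ! k \<in> set (x # xs)" using Cons.prems(2) by (rule nth_mem)
    ultimately have "\<not> (x # xs) ! k \<le> t" and "filter (\<lambda>x. x \<le> t) (x # xs) = []"
      unfolding filter_empty_conv by blast+
    then show ?thesis by simp
  qed
qed simp

text \<open>The order statistic with number \<open>i\<close> is at most \<open>t\<close> exactly
  when at least \<open>i\<close> sample values are, and their number is a finite sum of measurable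
  indicators.\<close>

lemma borel_measurable_order_statistic:
  assumes Y: "\<And>i. i \<in> {1..n} \<Longrightarrow> Y i \<in> borel_measurable M" and "i \<in> {1..n}"
  shows "order_statistic Y n i \<in> borel_measurable M"
  unfolding borel_measurable_iff_le
proof
  fix t :: real
  have count: "length (filter (\<lambda>x. x \<le> t) (map (\<lambda>j. Y j \<omega>) [1..<Suc n]))
      = (\<Sum>j\<in>{1..n}. if Y j \<omega> \<le> t then 1 else 0)" for \<omega>
    by (induction n) auto
  have "order_statistic Y n i \<omega> \<le> t
      \<longleftrightarrow> real (i - 1) < (\<Sum>j\<in>{1..n}. if Y j \<omega> \<le> t then 1 else 0)" for \<omega>
  proof -
    let ?xs = "map (\<lambda>j. Y j \<omega>) [1..<Suc n]"
    have "length (filter (\<lambda>x. x \<le> t) (sort ?xs)) = length (filter (\<lambda>x. x \<le> t) ?xs)"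
      by (metis filter_sort length_sort)
    then have "order_statistic Y n i \<omega> \<le> t \<longleftrightarrow> i - 1 < length (filter (\<lambda>x. x \<le> t) ?xs)"
      unfolding order_statistic_def using \<open>i \<in> {1..n}\<close>
      by (subst sorted_nth_le_iff) auto
    also have "\<dots> \<longleftrightarrow> real (i - 1) < real (\<Sum>j\<in>{1..n}. if Y j \<omega> \<le> t then 1 else 0)"
      unfolding count of_nat_less_iff ..
    finally show ?thesis by (simp add: if_distrib[of real] cong: if_cong)
  qed
  moreover have "{\<omega> \<in> space M. real (i - 1) < (\<Sum>j\<in>{1..n}. if Y j \<omega> \<le> t then 1 else 0)}
      \<in> sets M"
    using Y by (intro borel_measurable_less borel_measurable_const borel_measurable_sum
        measurable_If) auto
  ultimately show "{\<omega> \<in> space M. order_statistic Y n i \<omega> \<le> t} \<in> sets M" by simp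
qed

section \<open>Linear combinations of independent atomless variables\<close>

text \<open>Fubini: independence makes the joint law a product, and for each fixed value
  \<open>v\<close> of \<open>V\<close> the event \<open>U = - v\<close> is null.\<close>

lemma (in prob_space) AE_indep_add_neq_0:
  fixes U V :: "'a \<Rightarrow> real"
  assumes indep: "indep_var borel U borel V" and U: "\<And>y. AE \<omega> in M. U \<omega> \<noteq> y"
  shows "AE \<omega> in M. U \<omega> + V \<omega> \<noteq> 0"
proof -
  have rv [measurable]: "U \<in> borel_measurable M" "V \<in> borel_measurable M"
    and joint: "distr M borel U \<Otimes>\<^sub>M distr M borel V
      = distr M (borel \<Otimes>\<^sub>M borel) (\<lambda>\<omega>. (U \<omega>, V \<omega>))"
    using indep by (auto simp: indep_var_distribution_eq)
  interpret U: prob_space "distr M borel U" by (rule prob_space_distr) simp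
  interpret V: prob_space "distr M borel V" by (rule prob_space_distr) simp
  interpret pair_sigma_finite "distr M borel U" "distr M borel V" ..
  have "AE u in distr M borel U. u + v \<noteq> 0" for v
    using U[of "- v"] by (subst AE_distr_iff) (auto simp: add_eq_0_iff2)
  then have "AE v in distr M borel V. AE u in distr M borel U. u + v \<noteq> 0"
    by simp
  moreover have "{z \<in> space (borel \<Otimes>\<^sub>M borel). fst z + snd z \<noteq> (0::real)}
      \<in> sets (borel \<Otimes>\<^sub>M borel)"
    by measurable
  then have nz: "{z \<in> space (distr M borel U \<Otimes>\<^sub>M distr M borel V). fst z + snd z \<noteq> 0}
      \<in> sets (distr M borel U \<Otimes>\<^sub>M distr M borel V)"
    by (simp add: space_pair_measure cong: sets_pair_measure_cong)
  \<comment> \<open>The statement so far has the law of \<open>U\<close> inside; the passage to the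
    product measure wants it outside.\<close>
  ultimately have "AE u in distr M borel U. AE v in distr M borel V. u + v \<noteq> 0"
    using AE_commute[OF nz] by simp
  then have "AE z in distr M borel U \<Otimes>\<^sub>M distr M borel V. fst z + snd z \<noteq> 0"
    by (intro AE_pair_measure[OF nz]) simp
  then show ?thesis
    unfolding joint by (subst (asm) AE_distr_iff) auto
qed

text \<open>The term with index \<open>j\<close> is atomless because \<open>c j\<close> is nonzero,
  and it is independent of the sum of the other terms.\<close>

lemma (in prob_space) AE_indep_lincomb_neq_0:
  fixes Y :: "'i \<Rightarrow> 'a \<Rightarrow> real"
  assumes I: "finite I" and indep: "indep_vars (\<lambda>_. borel) Y I"
    and Y: "\<And>i y. i \<in> I \<Longrightarrow> AE \<omega> in M. Y i \<omega> \<noteq> y" and j: "j \<in> I" "c j \<noteq> 0"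
  shows "AE \<omega> in M. (\<Sum>i\<in>I. c i * Y i \<omega>) \<noteq> 0"
proof -
  have "indep_vars (\<lambda>_. borel) (\<lambda>i \<omega>. c i * Y i \<omega>) I"
    by (rule indep_vars_compose2[OF indep]) simp
  then have "indep_var borel (\<lambda>\<omega>. c j * Y j \<omega>) borel (\<lambda>\<omega>. \<Sum>i\<in>I - {j}. c i * Y i \<omega>)"
    using I j(1) by (intro indep_vars_sum) (auto simp: insert_absorb)
  moreover have "AE \<omega> in M. c j * Y j \<omega> \<noteq> y" for y
    using Y[OF j(1), of "y / c j"] j(2) by (auto simp: field_simps)
  ultimately show ?thesis
    using AE_indep_add_neq_0 I j(1) by (simp add: sum.remove)
qed

text \<open>A single point is Lebesgue null, so the density integrates to zero over it.\<close>

lemma (in prob_space) distributed_lborel_AE_neq: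
  assumes "distributed M lborel X g"
  shows "AE \<omega> in M. X \<omega> \<noteq> y"
proof -
  have X: "X \<in> borel_measurable M"
    using distributed_measurable[OF assms] by simp
  have "emeasure M (X -` {y} \<inter> space M) = (\<integral>\<^sup>+x. g x * indicator {y} x \<partial>lborel)"
    using assms by (rule distributed_emeasure) simp
  also have "\<dots> = 0"
    using AE_lborel_singleton[of y] by (subst nn_integral_0_iff_AE)
      (use distributed_borel_measurable[OF assms] in \<open>auto elim!: eventually_mono\<close>)
  finally have "emeasure M (X -` {y} \<inter> space M) = 0" .
  then show ?thesis
    by (intro AE_I[where N = "X -` {y} \<inter> space M"] measurable_sets[OF X]) auto
qed

text \<open>The order statistics are a permutation of the sample, so a vanishing linear combination
  of them is one of finitely many vanishing linear combinations of the sample.\<close>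

lemma (in prob_space) AE_order_statistics_lincomb_neq_0:
  assumes indep: "indep_vars (\<lambda>_. borel) Y {1..n}"
    and Y: "\<And>i y. i \<in> {1..n} \<Longrightarrow> AE \<omega> in M. Y i \<omega> \<noteq> y" and j: "j < n" "c j \<noteq> 0"
  shows "AE \<omega> in M. (\<Sum>k<n. c k * order_statistic Y n (Suc k) \<omega>) \<noteq> 0"
proof -
  have "AE \<omega> in M. (\<Sum>k<n. c k * Y (Suc (p k)) \<omega>) \<noteq> 0" if p: "p permutes {..<n}" for p
  proof -
    \<comment> \<open>Relabelling: the coefficient \<open>c k\<close> moves to the sample variable
      with number \<open>Suc (p k)\<close>.\<close>
    let ?d = "\<lambda>i. c (inv_into UNIV p (i - 1))"
    have "p j < n" using permutes_in_image[OF p] j(1) by simp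
    have "AE \<omega> in M. (\<Sum>i\<in>{1..n}. ?d i * Y i \<omega>) \<noteq> 0"
      using \<open>p j < n\<close> j permutes_inverses[OF p]
      by (intro AE_indep_lincomb_neq_0[OF _ indep Y, where j = "Suc (p j)"]) auto
    moreover have "(\<Sum>i\<in>{1..n}. ?d i * Y i \<omega>) = (\<Sum>k<n. c k * Y (Suc (p k)) \<omega>)" for \<omega>
    proof -
      have "(\<Sum>i\<in>{1..n}. ?d i * Y i \<omega>) = (\<Sum>k<n. c (inv_into UNIV p k) * Y (Suc k) \<omega>)"
        using sum.atLeast_Suc_atMost_Suc_shift[of "\<lambda>i. ?d i * Y i \<omega>" 0 "n - 1"]
        by (cases n) (auto simp: atLeast0AtMost lessThan_Suc_atMost)
      also have "\<dots> = (\<Sum>k<n. c (inv_into UNIV p (p k)) * Y (Suc (p k)) \<omega>)"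
        using sum.permute[OF p, of "\<lambda>k. c (inv_into UNIV p k) * Y (Suc k) \<omega>"] by (simp add: comp_def)
      finally show ?thesis using permutes_inverses[OF p] by simp
    qed
    ultimately show ?thesis by simp
  qed
  \<comment> \<open>The permutation varies with \<omega>, but there are only finitely many, so one
    null set serves them all.\<close>
  then have "AE \<omega> in M. \<forall>p\<in>{p. p permutes {..<n}}. (\<Sum>k<n. c k * Y (Suc (p k)) \<omega>) \<noteq> 0"
    by (subst AE_finite_all) (auto simp: finite_permutations)
  then show ?thesis
  proof (eventually_elim)
    case (elim \<omega>)
    show ?case
    proof (rule order_statistic_permutes[of n Y \<omega>])
      fix p
      assume "p permutes {..<n}"
        and "\<And>k. k < n \<Longrightarrow> order_statistic Y n (Suc k) \<omega> = Y (Suc (p k)) \<omega>"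
      then show "(\<Sum>k<n. c k * order_statistic Y n (Suc k) \<omega>) \<noteq> 0" using elim by simp
    qed
  qed
qed

section \<open>Second moments of linear combinations\<close>

lemma integrable_mult_square_integrable:
  fixes U V :: "'a \<Rightarrow> real"
  assumes [measurable]: "U \<in> borel_measurable M" "V \<in> borel_measurable M"
    and "integrable M (\<lambda>\<omega>. (U \<omega>)\<^sup>2)" "integrable M (\<lambda>\<omega>. (V \<omega>)\<^sup>2)"
  shows "integrable M (\<lambda>\<omega>. U \<omega> * V \<omega>)"
proof (rule Bochner_Integration.integrable_bound)
  show "integrable M (\<lambda>\<omega>. (U \<omega>)\<^sup>2 + (V \<omega>)\<^sup>2)" using assms by simp
  have "\<bar>u * v\<bar> \<le> u\<^sup>2 + v\<^sup>2" for u v :: real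
    using sum_squares_bound[of u v] sum_squares_bound[of u "- v"]
    by (simp add: abs_le_iff)
  then show "AE \<omega> in M. norm (U \<omega> * V \<omega>) \<le> norm ((U \<omega>)\<^sup>2 + (V \<omega>)\<^sup>2)" by simp
qed simp

lemma integral_lincomb_mult:
  fixes X :: "nat \<Rightarrow> 'a \<Rightarrow> real"
  assumes "\<And>i j. i < n \<Longrightarrow> j < n \<Longrightarrow> integrable M (\<lambda>\<omega>. X i \<omega> * X j \<omega>)"
  shows "integrable M (\<lambda>\<omega>. (\<Sum>i<n. x i * X i \<omega>) * (\<Sum>j<n. y j * X j \<omega>))"
    and "(\<integral>\<omega>. (\<Sum>i<n. x i * X i \<omega>) * (\<Sum>j<n. y j * X j \<omega>) \<partial>M)
      = bilin n (\<lambda>i j. \<integral>\<omega>. X i \<omega> * X j \<omega> \<partial>M) x y"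
proof -
  have eq: "(\<Sum>i<n. x i * X i \<omega>) * (\<Sum>j<n. y j * X j \<omega>)
      = (\<Sum>i<n. \<Sum>j<n. x i * y j * (X i \<omega> * X j \<omega>))" for \<omega>
    by (simp add: sum_product mult_ac)
  show "integrable M (\<lambda>\<omega>. (\<Sum>i<n. x i * X i \<omega>) * (\<Sum>j<n. y j * X j \<omega>))"
    unfolding eq using assms by (intro Bochner_Integration.integrable_sum) auto
  have "(\<integral>\<omega>. (\<Sum>i<n. x i * X i \<omega>) * (\<Sum>j<n. y j * X j \<omega>) \<partial>M)
      = (\<Sum>i<n. \<Sum>j<n. \<integral>\<omega>. x i * y j * (X i \<omega> * X j \<omega>) \<partial>M)"
    unfolding eq using assms
    by (subst Bochner_Integration.integral_sum)
      (auto intro!: sum.cong Bochner_Integration.integral_sum)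
  also have "\<dots> = bilin n (\<lambda>i j. \<integral>\<omega>. X i \<omega> * X j \<omega> \<partial>M) x y"
    by (simp add: bilin_def mult_ac)
  finally show "(\<integral>\<omega>. (\<Sum>i<n. x i * X i \<omega>) * (\<Sum>j<n. y j * X j \<omega>) \<partial>M)
      = bilin n (\<lambda>i j. \<integral>\<omega>. X i \<omega> * X j \<omega> \<partial>M) x y" .
qed

text \<open>The value at \<open>c\<close> is the expected square of a linear combination. If it were
  zero, the combination would vanish almost everywhere, against \<open>nz\<close>.\<close>

lemma (in prob_space) pos_def_form_second_moments:
  fixes X :: "nat \<Rightarrow> 'a \<Rightarrow> real"
  assumes int: "\<And>i j. i < n \<Longrightarrow> j < n \<Longrightarrow> integrable M (\<lambda>\<omega>. X i \<omega> * X j \<omega>)"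
    and nz: "\<And>c j. j < n \<Longrightarrow> c j \<noteq> 0 \<Longrightarrow> AE \<omega> in M. (\<Sum>k<n. c k * X k \<omega>) \<noteq> 0"
  shows "pos_def_form n (\<lambda>i j. \<integral>\<omega>. X i \<omega> * X j \<omega> \<partial>M)"
  unfolding pos_def_form_def
proof (intro conjI allI impI)
  show "symm_form n (\<lambda>i j. \<integral>\<omega>. X i \<omega> * X j \<omega> \<partial>M)"
    by (simp add: symm_form_def mult.commute)
  fix c :: "nat \<Rightarrow> real"
  assume "\<exists>i<n. c i \<noteq> 0"
  then have ae: "AE \<omega> in M. (\<Sum>k<n. c k * X k \<omega>) \<noteq> 0" using nz by blast
  let ?S = "\<lambda>\<omega>. (\<Sum>k<n. c k * X k \<omega>) * (\<Sum>k<n. c k * X k \<omega>)"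
  have "(\<integral>\<omega>. ?S \<omega> \<partial>M) \<noteq> 0"
  proof
    assume "(\<integral>\<omega>. ?S \<omega> \<partial>M) = 0"
    then have "AE \<omega> in M. ?S \<omega> = 0"
      using integral_lincomb_mult(1)[OF int] by (subst (asm) integral_nonneg_eq_0_iff_AE) auto
    with ae have "AE \<omega> in M. False" by eventually_elim simp
    then show False by simp
  qed
  moreover have "0 \<le> (\<integral>\<omega>. ?S \<omega> \<partial>M)" by (rule Bochner_Integration.integral_nonneg) simp
  ultimately show "0 < bilin n (\<lambda>i j. \<integral>\<omega>. X i \<omega> * X j \<omega> \<partial>M) c c"
    using integral_lincomb_mult(2)[OF int] by simp
qed

section \<open>Prediction errors and the two minimization problems\<close>

lemma prediction_error_eq:
  assumes "r \<le> n" and "s \<in> {1..n}"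
  shows "prediction_error Y n r s a \<omega>
    = (\<Sum>k<n. error_coeffs r (s - 1) a k * order_statistic Y n (Suc k) \<omega>)"
proof -
  have "(\<Sum>k<n. order_statistic Y n (Suc k) \<omega> * error_coeffs r (s - 1) a k)
      = (\<Sum>k<r. order_statistic Y n (Suc k) \<omega> * vec_index a k) - order_statistic Y n s \<omega>"
    using assms by (subst sum_mult_error_coeffs) auto
  also have "(\<Sum>k<r. order_statistic Y n (Suc k) \<omega> * vec_index a k)
      = scalar_prod a (observed Y n r \<omega>)"
    by (simp add: scalar_prod_def observed_def atLeast0LessThan mult.commute)
  finally show ?thesis by (simp add: prediction_error_def mult.commute)
qed

text \<open>A strict minimum excludes every other minimizer, so strict inequalities settle existence
  and uniqueness together.\<close>

lemma is_arg_min_iff_strict_min: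
  fixes f :: "'a \<Rightarrow> 'b::order"
  assumes "P a" and "\<And>b. P b \<Longrightarrow> b \<noteq> a \<Longrightarrow> f a < f b"
  shows "is_arg_min f P b \<longleftrightarrow> b = a"
  unfolding is_arg_min_def using assms by (metis less_asym)

theorem theorem3:
  fixes M :: "'a measure" and Y :: "nat \<Rightarrow> 'a \<Rightarrow> real" and f :: "real \<Rightarrow> real"
    and \<mu> \<sigma> :: real and n r l :: nat and ss :: "nat list"
  assumes "prob_space M"
    and "f \<in> borel_measurable borel" and "\<And>x. 0 \<le> f x"
    and "(\<integral>\<^sup>+ x. ennreal (f x) \<partial>lborel) = 1"
    and "0 < \<sigma>"
    and "1 \<le> r" and "r < n"
    and "1 \<le> l" and "length ss = l" and "sorted_wrt (<) ss"
    and "\<And>s. s \<in> set ss \<Longrightarrow> r < s \<and> s \<le> n"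
    and "prob_space.indep_vars M (\<lambda>_. borel) Y {1..n}"
    and "\<And>i. i \<in> {1..n} \<Longrightarrow>
      distributed M lborel (Y i) (\<lambda>x. ennreal (1 / \<sigma> * f ((x - \<mu>) / \<sigma>)))"
    and "\<And>i. i \<in> {1..n} \<Longrightarrow>
      integrable M (\<lambda>\<omega>. ((order_statistic Y n i \<omega> - \<mu>) / \<sigma>)\<^sup>2)"
    and "positive_definite
      (covariance_matrix M r (\<lambda>i \<omega>. (order_statistic Y n i \<omega> - \<mu>) / \<sigma>))"
  shows "(\<exists>!as. simultaneous_BLIP M Y n r ss as)
    \<and> (\<forall>i<l. \<exists>!a. marginal_BLIP M Y n r (ss ! i) a)
    \<and> (\<forall>as. simultaneous_BLIP M Y n r ss as \<longleftrightarrow>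
          length as = l \<and> (\<forall>i<l. marginal_BLIP M Y n r (ss ! i) (as ! i)))"
proof -
  interpret prob_space M by fact
  define X where "X k = order_statistic Y n (Suc k)" for k
  \<comment> \<open>Uncentred second moments of all \<open>n\<close> order statistics, observed or
    not; every mean squared error, bias included, is a value of this form.\<close>
  define m where "m = (\<lambda>i j. \<integral>\<omega>. X i \<omega> * X j \<omega> \<partial>M)"
  have X [measurable]: "X k \<in> borel_measurable M" if "k < n" for k
    unfolding X_def using assms(12) that
    by (intro borel_measurable_order_statistic) (auto simp: indep_vars_def)
  have "integrable M (\<lambda>\<omega>. (X k \<omega>)\<^sup>2)" if "k < n" for k
  proof -
    let ?Z = "\<lambda>\<omega>. (X k \<omega> - \<mu>) / \<sigma>"
    have [measurable]: "X k \<in> borel_measurable M" using X that .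
    have Z2: "integrable M (\<lambda>\<omega>. (?Z \<omega>)\<^sup>2)"
      unfolding X_def using assms(14)[of "Suc k"] that by simp
    have "?Z \<in> borel_measurable M" by measurable
    then have "integrable M ?Z" using Z2 by (rule square_integrable_imp_integrable)
    \<comment> \<open>The expansion of the square of \<open>\<mu> + \<sigma> * ?Z \<omega>\<close>,
      which is \<open>X k \<omega>\<close>.\<close>
    with Z2 have "integrable M (\<lambda>\<omega>. \<mu>\<^sup>2 + (2 * \<mu> * \<sigma>) * ?Z \<omega> + \<sigma>\<^sup>2 * (?Z \<omega>)\<^sup>2)"
      by (intro Bochner_Integration.integrable_add integrable_mult_right integrable_const)
    moreover have "\<mu>\<^sup>2 + (2 * \<mu> * \<sigma>) * ?Z \<omega> + \<sigma>\<^sup>2 * (?Z \<omega>)\<^sup>2 = (X k \<omega>)\<^sup>2" for \<omega>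
      using assms(5) by (simp add: power_divide) (simp add: power2_eq_square algebra_simps)
    ultimately show ?thesis by (simp only:)
  qed
  then have int: "integrable M (\<lambda>\<omega>. X i \<omega> * X j \<omega>)" if "i < n" "j < n" for i j
    using that X by (intro integrable_mult_square_integrable) auto
  have m: "pos_def_form n m"
    unfolding m_def
  proof (rule pos_def_form_second_moments[OF int])
    fix c :: "nat \<Rightarrow> real" and j
    assume "j < n" "c j \<noteq> 0"
    then show "AE \<omega> in M. (\<Sum>k<n. c k * X k \<omega>) \<noteq> 0"
      unfolding X_def using assms(13)
      by (intro AE_order_statistics_lincomb_neq_0[OF assms(12)])
        (auto intro: distributed_lborel_AE_neq)
  qed
  have rn: "r \<le> n" using assms(7) by simp
  have error: "(\<integral>\<omega>. prediction_error Y n r s a \<omega> * prediction_error Y n r t b \<omega> \<partial>M)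
      = bilin n m (error_coeffs r (s - 1) a) (error_coeffs r (t - 1) b)"
    if "s \<in> {1..n}" "t \<in> {1..n}" for s t a b
    unfolding prediction_error_eq[OF rn that(1)] prediction_error_eq[OF rn that(2)] m_def
    using integral_lincomb_mult(2)[OF int] by (simp add: X_def)
  have ss: "ss ! i \<in> {1..n}" "r \<le> ss ! i - 1" "ss ! i - 1 < n" if "i < l" for i
    using assms(11)[OF nth_mem, of i] assms(9) that by auto
  have inj: "inj_on (\<lambda>i. ss ! i - 1) {..<l}"
  proof (rule inj_onI)
    fix i j
    assume "i \<in> {..<l}" "j \<in> {..<l}" "ss ! i - 1 = ss ! j - 1"
    \<comment> \<open>Truncated subtraction of 1 loses nothing, as both targets are at least
      1.\<close>
    then have "ss ! i = ss ! j" using ss(1)[of i] ss(1)[of j] by auto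
    moreover have "distinct ss" using assms(10) by (simp add: strict_sorted_iff)
    ultimately show "i = j"
      using \<open>i \<in> {..<l}\<close> \<open>j \<in> {..<l}\<close> assms(9) by (simp add: nth_eq_iff_index_eq)
  qed
  have "\<exists>a. normal_equations n m r (ss ! i - 1) a" if "i < l" for i
    using normal_equations_solvable[OF m rn ss(3)[OF that]] .
  \<comment> \<open>Each target gets its own solution; this one family will solve both minimization
    problems.\<close>
  then obtain opt where opt: "\<And>i. i < l \<Longrightarrow> normal_equations n m r (ss ! i - 1) (opt i)"
    by metis
  have carrier: "opt i \<in> carrier_vec r" if "i < l" for i
    using opt[OF that] by (simp add: normal_equations_def)
  have marginal: "marginal_BLIP M Y n r (ss ! i) a \<longleftrightarrow> a = opt i" if "i < l" for i a
    unfolding marginal_BLIP_def power2_eq_square error[OF ss(1)[OF that] ss(1)[OF that]]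
    using carrier[OF that] bilin_error_coeffs_minimal[OF m rn opt[OF that]]
    by (rule is_arg_min_iff_strict_min)
  define opts where "opts = map opt [0..<l]"
  have opts: "length opts = l" "\<And>i. i < l \<Longrightarrow> opts ! i = opt i"
    by (simp_all add: opts_def)
  have det: "Determinant.det (mspe_matrix M Y n r ss as) = form_det l (\<lambda>i j.
      bilin n m (error_coeffs r (ss ! i - 1) (as ! i)) (error_coeffs r (ss ! j - 1) (as ! j)))" for as
    unfolding mspe_matrix_def form_det_def assms(9)
    by (intro arg_cong[of _ _ Determinant.det] cong_mat) (auto simp: error[OF ss(1) ss(1)])
  have simultaneous: "simultaneous_BLIP M Y n r ss as \<longleftrightarrow> as = opts" for as
    unfolding simultaneous_BLIP_def
  proof (rule is_arg_min_iff_strict_min)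
    show "length opts = length ss \<and> set opts \<subseteq> carrier_vec r"
      using carrier assms(9) by (auto simp: opts_def)
    fix bs :: "real Matrix.vec list"
    assume bs: "length bs = length ss \<and> set bs \<subseteq> carrier_vec r" and "bs \<noteq> opts"
    then have "\<exists>i<l. bs ! i \<noteq> opts ! i"
      using opts(1) assms(9) by (metis nth_equalityI)
    moreover have "bs ! i \<in> carrier_vec r" if "i < l" for i
      using bs assms(9) that by (metis nth_mem subsetD)
    ultimately show "Determinant.det (mspe_matrix M Y n r ss opts)
        < Determinant.det (mspe_matrix M Y n r ss bs)"
      unfolding det using ss(2,3) opt opts(2)
      by (intro form_det_error_coeffs_minimal[OF m rn inj]) auto
  qed
  \<comment> \<open>Both notions now mean equality with the optimal coefficients, so their
    equivalence is entrywise equality of lists.\<close>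
  have "as = opts \<longleftrightarrow> length as = l \<and> (\<forall>i<l. as ! i = opt i)" for as
    using opts by (auto intro: nth_equalityI)
  then have "\<forall>as. simultaneous_BLIP M Y n r ss as
      \<longleftrightarrow> length as = l \<and> (\<forall>i<l. marginal_BLIP M Y n r (ss ! i) (as ! i))"
    by (simp add: simultaneous marginal)
  moreover have "\<exists>!as. simultaneous_BLIP M Y n r ss as"
    by (simp add: simultaneous)
  moreover have "\<forall>i<l. \<exists>!a. marginal_BLIP M Y n r (ss ! i) a"
    by (simp add: marginal)
  ultimately show ?thesis by blast
qed

end
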